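(* Let $(\mathcal{M}, g, A)$ be a K\"ahler manifold of dimension $n$ with a quarter-symmetric metric $A$-connection $\overset{1}{\nabla}_XY=\overset{g}{\nabla}_XY-\pi(X)AY$ with generator $\pi$. The tensor $$\begin{aligned}\overset{4}{H}(X,Y)Z={}&\overset{4}{R}(X,Y)Z-\overset{4}{'R}(AY,X)AZ+\overset{4}{'R}(AZ,Y)AX\\&-\frac{1}{n-1}\Big(\overset{4}{R}ic(Y,Z)X-\overset{4}{R}ic(X,Z)Y-\overset{4}{'R}(AY,AZ)X+\overset{4}{'R}(AX,AZ)Y\Big)\end{aligned}$$ is independent of the generator $\pi$ (for any two 1-forms $\pi,\tilde\pi$ the tensors $\overset{4}{H}$ constructed from them coincide) and it is equal to the Weyl projective curvature tensor $$\overset{g}{W}(X,Y)Z=\overset{g}{R}(X,Y)Z+\frac{1}{n-1}\big(\overset{g}{R}ic(X,Z)Y-\overset{g}{R}ic(Y,Z)X\big).$$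
   Context: A K\"ahler manifold $(\mathcal{M},g,A)$ is a Riemannian manifold $(\mathcal{M},g)$ of dimension $n=2k\ge4$ with a $(1,1)$ tensor field $A$ satisfying $A^2=-I$, $g(AX,AY)=g(X,Y)$ and $\overset{g}{\nabla}A=0$, where $\overset{g}{\nabla}$ is the Levi-Civita connection. $\overset{g}{R}$ is the Riemannian curvature tensor of $g$, $\overset{g}{R}(X,Y)Z=\overset{g}{\nabla}_X\overset{g}{\nabla}_YZ-\overset{g}{\nabla}_Y\overset{g}{\nabla}_XZ-\overset{g}{\nabla}_{[X,Y]}Z$, and $\overset{g}{R}ic(Y,Z)=\mathrm{Trace}\{X\mapsto\overset{g}{R}(X,Y)Z\}$. For a 1-form $\pi$ (the generator), the curvature tensor of the fourth kind is $$\overset{4}{R}(X,Y)Z=\overset{g}{R}(X,Y)Z-\overset{3}{D}(X,Y)AZ+\overset{3}{D}(Y,Z)AX+\pi(Z)\big(\pi(Y)X-\pi(X)Y\big),$$ where $\overset{3}{D}(X,Y)=(\overset{g}{\nabla}_X\pi)(Y)+\pi(X)\pi(AY)$. Moreover $\overset{4}{R}ic(Y,Z)=\mathrm{Trace}\{X\mapsto\overset{4}{R}(X,Y)Z\}$ and $\overset{4}{'R}(X,Y)=\mathrm{Trace}\{Z\mapsto\overset{4}{R}(X,Y)Z\}$. *)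

theory Defs
  imports "HOL-Analysis.Analysis"
begin

section \<open>Smooth maps between Euclidean spaces\<close>

text \<open>On an open set \<open>S\<close>, \<open>Ck_on k f S\<close> says that \<open>f\<close> is \<open>k\<close> times continuously differentiable
  (all directional derivatives of order up to \<open>k\<close> exist and are continuous).\<close>

fun Ck_on :: "nat \<Rightarrow> ('a::euclidean_space \<Rightarrow> 'b::real_normed_vector) \<Rightarrow> 'a set \<Rightarrow> bool" where
  "Ck_on 0 f S \<longleftrightarrow> continuous_on S f"
| "Ck_on (Suc k) f S \<longleftrightarrow>
     (\<forall>x\<in>S. f differentiable (at x)) \<and> (\<forall>v. Ck_on k (\<lambda>x. frechet_derivative f (at x) v) S)"

definition smooth_on :: "('a::euclidean_space \<Rightarrow> 'b::real_normed_vector) \<Rightarrow> 'a set \<Rightarrow> bool" where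
  "smooth_on f S \<longleftrightarrow> (\<forall>k. Ck_on k f S)"


section \<open>Smooth manifolds\<close>

text \<open>The manifold is a whole type \<open>'m\<close>, Hausdorff and second countable.  A chart is a pair of a
  domain and a coordinate map, of which only the values on the domain matter.  The dimension is
  \<open>CARD('n)\<close>.\<close>

type_synonym ('m, 'n) chart = "'m set \<times> ('m \<Rightarrow> real ^ 'n)"

abbreviation cdom :: "('m, 'n) chart \<Rightarrow> 'm set" where "cdom c \<equiv> fst c"
abbreviation cmap :: "('m, 'n) chart \<Rightarrow> 'm \<Rightarrow> real ^ 'n" where "cmap c \<equiv> snd c"

definition cinv :: "('m, 'n) chart \<Rightarrow> real ^ 'n \<Rightarrow> 'm" where
  "cinv c = inv_into (cdom c) (cmap c)"

definition is_chart :: "('m::topological_space, 'n::finite) chart \<Rightarrow> bool" where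
  "is_chart c \<longleftrightarrow> open (cdom c) \<and> open (cmap c ` cdom c) \<and>
     homeomorphism (cdom c) (cmap c ` cdom c) (cmap c) (cinv c)"

definition smooth_atlas ::
  "('m::{t2_space, second_countable_topology}, 'n::finite) chart set \<Rightarrow> bool" where
  "smooth_atlas At \<longleftrightarrow>
     (\<forall>c\<in>At. is_chart c) \<and> (\<Union>c\<in>At. cdom c) = UNIV \<and>
     (\<forall>c\<in>At. \<forall>d\<in>At. smooth_on (cmap d \<circ> cinv c) (cmap c ` (cdom c \<inter> cdom d)))"

text \<open>The tangent space at \<open>p\<close> is \<open>\<real>\<^sup>n\<close>, identified with the usual tangent space by means of one chart
  \<open>chart_at At p\<close> around \<open>p\<close>, selected once and for all.  A section of the tangent bundle is thus a
  function \<open>'m \<Rightarrow> real ^ 'n\<close>; since the selected chart may jump from point to point, smoothness of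
  a section has to be read off from its components in a fixed chart, see \<open>vf_rep\<close>.\<close>

definition chart_at :: "('m, 'n) chart set \<Rightarrow> 'm \<Rightarrow> ('m, 'n) chart" where
  "chart_at At p = (SOME c. c \<in> At \<and> p \<in> cdom c)"

text \<open>Components with respect to the chart \<open>c\<close> of the tangent vector \<open>v\<close> at \<open>p \<in> cdom c\<close>; and
  conversely the tangent vector at \<open>p\<close> with components \<open>a\<close> in the chart \<open>c\<close>.\<close>

definition tcoord :: "('m, 'n::finite) chart set \<Rightarrow> ('m, 'n) chart \<Rightarrow> 'm \<Rightarrow> real ^ 'n \<Rightarrow> real ^ 'n" where
  "tcoord At c p v =
     frechet_derivative (cmap c \<circ> cinv (chart_at At p)) (at (cmap (chart_at At p) p)) v"

definition tvec :: "('m, 'n::finite) chart set \<Rightarrow> ('m, 'n) chart \<Rightarrow> 'm \<Rightarrow> real ^ 'n \<Rightarrow> real ^ 'n" where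
  "tvec At c p a = frechet_derivative (cmap (chart_at At p) \<circ> cinv c) (at (cmap c p)) a"

definition smooth_fun ::
  "('m::topological_space, 'n::finite) chart set \<Rightarrow> 'm set \<Rightarrow> ('m \<Rightarrow> real) \<Rightarrow> bool" where
  "smooth_fun At U f \<longleftrightarrow> (\<forall>c\<in>At. smooth_on (f \<circ> cinv c) (cmap c ` (U \<inter> cdom c)))"

definition vf_rep ::
  "('m, 'n::finite) chart set \<Rightarrow> ('m, 'n) chart \<Rightarrow> ('m \<Rightarrow> real ^ 'n) \<Rightarrow> real ^ 'n \<Rightarrow> real ^ 'n" where
  "vf_rep At c X = (\<lambda>x. tcoord At c (cinv c x) (X (cinv c x)))"

text \<open>Smooth vector fields on an open set \<open>U\<close>; values outside \<open>U\<close> are irrelevant.\<close>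

definition smooth_vf ::
  "('m::topological_space, 'n::finite) chart set \<Rightarrow> 'm set \<Rightarrow> ('m \<Rightarrow> real ^ 'n) \<Rightarrow> bool" where
  "smooth_vf At U X \<longleftrightarrow> (\<forall>c\<in>At. smooth_on (vf_rep At c X) (cmap c ` (U \<inter> cdom c)))"

text \<open>The derivative \<open>v f\<close> of a function \<open>f\<close> along the tangent vector \<open>v\<close> at \<open>p\<close>.\<close>

definition dird ::
  "('m, 'n::finite) chart set \<Rightarrow> ('m \<Rightarrow> real) \<Rightarrow> 'm \<Rightarrow> real ^ 'n \<Rightarrow> real" where
  "dird At f p v =
     frechet_derivative (f \<circ> cinv (chart_at At p)) (at (cmap (chart_at At p) p)) v"

text \<open>The Lie bracket \<open>[X,Y]\<close> at \<open>p\<close>, by its coordinate expression \<open>X\<^sup>i \<partial>\<^sub>i Y - Y\<^sup>i \<partial>\<^sub>i X\<close> in the selected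
  chart at \<open>p\<close>.\<close>

definition lie_bracket ::
  "('m, 'n::finite) chart set \<Rightarrow> ('m \<Rightarrow> real ^ 'n) \<Rightarrow> ('m \<Rightarrow> real ^ 'n) \<Rightarrow> 'm \<Rightarrow> real ^ 'n" where
  "lie_bracket At X Y p =
     (let c = chart_at At p; x = cmap c p in
        frechet_derivative (vf_rep At c Y) (at x) (X p) -
        frechet_derivative (vf_rep At c X) (at x) (Y p))"

text \<open>Extension of a tangent vector \<open>v\<close> at \<open>p\<close> to a smooth vector field near \<open>p\<close>: the field with
  constant components in the selected chart at \<open>p\<close>.\<close>

definition ext_vf :: "('m, 'n::finite) chart set \<Rightarrow> 'm \<Rightarrow> real ^ 'n \<Rightarrow> 'm \<Rightarrow> real ^ 'n" where
  "ext_vf At p v = (\<lambda>q. tvec At (chart_at At p) q v)"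

definition one_form ::
  "('m::topological_space, 'n::finite) chart set \<Rightarrow> ('m \<Rightarrow> real ^ 'n \<Rightarrow> real) \<Rightarrow> bool" where
  "one_form At \<pi> \<longleftrightarrow> (\<forall>p. linear (\<pi> p)) \<and>
     (\<forall>U X. open U \<and> smooth_vf At U X \<longrightarrow> smooth_fun At U (\<lambda>p. \<pi> p (X p)))"

definition tensor11 ::
  "('m::topological_space, 'n::finite) chart set \<Rightarrow> ('m \<Rightarrow> real ^ 'n \<Rightarrow> real ^ 'n) \<Rightarrow> bool" where
  "tensor11 At A \<longleftrightarrow> (\<forall>p. linear (A p)) \<and>
     (\<forall>U X. open U \<and> smooth_vf At U X \<longrightarrow> smooth_vf At U (\<lambda>p. A p (X p)))"


section \<open>Riemannian and Kaehler manifolds\<close>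

definition riemannian_metric ::
  "('m::topological_space, 'n::finite) chart set \<Rightarrow> ('m \<Rightarrow> real ^ 'n \<Rightarrow> real ^ 'n \<Rightarrow> real) \<Rightarrow> bool" where
  "riemannian_metric At g \<longleftrightarrow>
     (\<forall>p. bilinear (g p) \<and> (\<forall>v w. g p v w = g p w v) \<and> (\<forall>v. v \<noteq> 0 \<longrightarrow> g p v v > 0)) \<and>
     (\<forall>U X Y. open U \<and> smooth_vf At U X \<and> smooth_vf At U Y \<longrightarrow>
        smooth_fun At U (\<lambda>p. g p (X p) (Y p)))"

text \<open>\<open>nabla p v Y\<close> is \<open>(\<nabla>\<^sub>v Y)(p)\<close>; it is meaningful when \<open>Y\<close> is smooth on a neighbourhood of \<open>p\<close>.
  That it depends only on the germ of \<open>Y\<close> follows from the Leibniz rule, applied to functions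
  \<open>f\<close> which are constant near \<open>p\<close>.\<close>

type_synonym ('m, 'n) conn = "'m \<Rightarrow> real ^ 'n \<Rightarrow> ('m \<Rightarrow> real ^ 'n) \<Rightarrow> real ^ 'n"

definition affine_connection ::
  "('m::topological_space, 'n::finite) chart set \<Rightarrow> ('m, 'n) conn \<Rightarrow> bool" where
  "affine_connection At nabla \<longleftrightarrow>
     (\<forall>U Y. open U \<and> smooth_vf At U Y \<longrightarrow>
        (\<forall>p\<in>U. linear (\<lambda>v. nabla p v Y)) \<and>
        (\<forall>X. smooth_vf At U X \<longrightarrow> smooth_vf At U (\<lambda>p. nabla p (X p) Y)) \<and>
        (\<forall>Z. smooth_vf At U Z \<longrightarrow>
           (\<forall>p\<in>U. \<forall>v. nabla p v (\<lambda>q. Y q + Z q) = nabla p v Y + nabla p v Z)) \<and>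
        (\<forall>f. smooth_fun At U f \<longrightarrow>
           (\<forall>p\<in>U. \<forall>v. nabla p v (\<lambda>q. f q *\<^sub>R Y q) = dird At f p v *\<^sub>R Y p + f p *\<^sub>R nabla p v Y)))"

definition levi_civita ::
  "('m::topological_space, 'n::finite) chart set \<Rightarrow> ('m \<Rightarrow> real ^ 'n \<Rightarrow> real ^ 'n \<Rightarrow> real) \<Rightarrow>
   ('m, 'n) conn \<Rightarrow> bool" where
  "levi_civita At g nabla \<longleftrightarrow> affine_connection At nabla \<and>
     (\<forall>U X Y. open U \<and> smooth_vf At U X \<and> smooth_vf At U Y \<longrightarrow>
        (\<forall>p\<in>U. nabla p (X p) Y - nabla p (Y p) X = lie_bracket At X Y p)) \<and>
     (\<forall>U Y Z. open U \<and> smooth_vf At U Y \<and> smooth_vf At U Z \<longrightarrow>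
        (\<forall>p\<in>U. \<forall>v. dird At (\<lambda>q. g q (Y q) (Z q)) p v =
           g p (nabla p v Y) (Z p) + g p (Y p) (nabla p v Z)))"

definition parallel11 ::
  "('m::topological_space, 'n::finite) chart set \<Rightarrow> ('m, 'n) conn \<Rightarrow>
   ('m \<Rightarrow> real ^ 'n \<Rightarrow> real ^ 'n) \<Rightarrow> bool" where
  "parallel11 At nabla A \<longleftrightarrow>
     (\<forall>U Y. open U \<and> smooth_vf At U Y \<longrightarrow>
        (\<forall>p\<in>U. \<forall>v. nabla p v (\<lambda>q. A q (Y q)) - A p (nabla p v Y) = 0))"

definition kaehler_manifold ::
  "('m::{t2_space, second_countable_topology}, 'n::finite) chart set \<Rightarrow>
   ('m \<Rightarrow> real ^ 'n \<Rightarrow> real ^ 'n \<Rightarrow> real) \<Rightarrow> ('m \<Rightarrow> real ^ 'n \<Rightarrow> real ^ 'n) \<Rightarrow>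
   ('m, 'n) conn \<Rightarrow> bool" where
  "kaehler_manifold At g A nabla \<longleftrightarrow>
     smooth_atlas At \<and> even CARD('n) \<and> CARD('n) \<ge> 4 \<and>
     riemannian_metric At g \<and> levi_civita At g nabla \<and> tensor11 At A \<and>
     (\<forall>p v. A p (A p v) = - v) \<and>
     (\<forall>p v w. g p (A p v) (A p w) = g p v w) \<and>
     parallel11 At nabla A"

definition quarter_symmetric_conn ::
  "('m, 'n) conn \<Rightarrow> ('m \<Rightarrow> real ^ 'n \<Rightarrow> real ^ 'n) \<Rightarrow> ('m \<Rightarrow> real ^ 'n \<Rightarrow> real) \<Rightarrow>
   ('m, 'n) conn" where
  "quarter_symmetric_conn nabla A \<pi> = (\<lambda>p v Y. nabla p v Y - \<pi> p v *\<^sub>R A p (Y p))"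


section \<open>Curvature tensors\<close>

text \<open>A tensor of type (1,3) assigns to every point \<open>p\<close> the map \<open>(X, Y, Z) \<mapsto> T(X,Y)Z\<close> on the
  tangent space at \<open>p\<close>.\<close>

type_synonym ('m, 'n) tensor13 =
  "'m \<Rightarrow> real ^ 'n \<Rightarrow> real ^ 'n \<Rightarrow> real ^ 'n \<Rightarrow> real ^ 'n"

definition curv_op ::
  "('m, 'n::finite) chart set \<Rightarrow> ('m, 'n) conn \<Rightarrow> ('m \<Rightarrow> real ^ 'n) \<Rightarrow> ('m \<Rightarrow> real ^ 'n) \<Rightarrow>
   ('m \<Rightarrow> real ^ 'n) \<Rightarrow> 'm \<Rightarrow> real ^ 'n" where
  "curv_op At nabla X Y Z p =
     nabla p (X p) (\<lambda>q. nabla q (Y q) Z) - nabla p (Y p) (\<lambda>q. nabla q (X q) Z)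
     - nabla p (lie_bracket At X Y p) Z"

text \<open>The value of the curvature tensor, and of \<open>\<nabla>\<pi>\<close>, on tangent vectors at \<open>p\<close> is obtained by
  extending these to local vector fields; by tensoriality the choice of the extension is
  immaterial.\<close>

definition riem ::
  "('m, 'n::finite) chart set \<Rightarrow> ('m, 'n) conn \<Rightarrow> ('m, 'n) tensor13" where
  "riem At nabla p x y z =
     curv_op At nabla (ext_vf At p x) (ext_vf At p y) (ext_vf At p z) p"

definition nabla_form ::
  "('m, 'n::finite) chart set \<Rightarrow> ('m, 'n) conn \<Rightarrow> ('m \<Rightarrow> real ^ 'n \<Rightarrow> real) \<Rightarrow>
   'm \<Rightarrow> real ^ 'n \<Rightarrow> real ^ 'n \<Rightarrow> real" where
  "nabla_form At nabla \<pi> p x y =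
     (let Y = ext_vf At p y in dird At (\<lambda>q. \<pi> q (Y q)) p x - \<pi> p (nabla p x Y))"

text \<open>The traces of \<open>X \<mapsto> T(X,Y)Z\<close> and of \<open>Z \<mapsto> T(X,Y)Z\<close>, respectively.\<close>

definition ricci :: "('m, 'n::finite) tensor13 \<Rightarrow> 'm \<Rightarrow> real ^ 'n \<Rightarrow> real ^ 'n \<Rightarrow> real" where
  "ricci T p y z = trace (matrix (\<lambda>x. T p x y z))"

definition trace_end :: "('m, 'n::finite) tensor13 \<Rightarrow> 'm \<Rightarrow> real ^ 'n \<Rightarrow> real ^ 'n \<Rightarrow> real" where
  "trace_end T p x y = trace (matrix (\<lambda>z. T p x y z))"

definition D3 ::
  "('m, 'n::finite) chart set \<Rightarrow> ('m, 'n) conn \<Rightarrow> ('m \<Rightarrow> real ^ 'n \<Rightarrow> real ^ 'n) \<Rightarrow>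
   ('m \<Rightarrow> real ^ 'n \<Rightarrow> real) \<Rightarrow> 'm \<Rightarrow> real ^ 'n \<Rightarrow> real ^ 'n \<Rightarrow> real" where
  "D3 At nabla A \<pi> p x y = nabla_form At nabla \<pi> p x y + \<pi> p x * \<pi> p (A p y)"

definition R4 ::
  "('m, 'n::finite) chart set \<Rightarrow> ('m, 'n) conn \<Rightarrow> ('m \<Rightarrow> real ^ 'n \<Rightarrow> real ^ 'n) \<Rightarrow>
   ('m \<Rightarrow> real ^ 'n \<Rightarrow> real) \<Rightarrow> ('m, 'n) tensor13" where
  "R4 At nabla A \<pi> p x y z =
     riem At nabla p x y z - D3 At nabla A \<pi> p x y *\<^sub>R A p z + D3 At nabla A \<pi> p y z *\<^sub>R A p x
     + \<pi> p z *\<^sub>R (\<pi> p y *\<^sub>R x - \<pi> p x *\<^sub>R y)"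

definition H4 ::
  "('m, 'n::finite) chart set \<Rightarrow> ('m, 'n) conn \<Rightarrow> ('m \<Rightarrow> real ^ 'n \<Rightarrow> real ^ 'n) \<Rightarrow>
   ('m \<Rightarrow> real ^ 'n \<Rightarrow> real) \<Rightarrow> ('m, 'n) tensor13" where
  "H4 At nabla A \<pi> p x y z =
     (let R = R4 At nabla A \<pi>; Ric = ricci R; R' = trace_end R; J = A p in
        R p x y z - R' p (J y) x *\<^sub>R J z + R' p (J z) y *\<^sub>R J x
        - (1 / (real CARD('n) - 1)) *\<^sub>R
            (Ric p y z *\<^sub>R x - Ric p x z *\<^sub>R y - R' p (J y) (J z) *\<^sub>R x + R' p (J x) (J z) *\<^sub>R y))"

definition weyl_projective ::
  "('m, 'n::finite) chart set \<Rightarrow> ('m, 'n) conn \<Rightarrow> ('m, 'n) tensor13" where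
  "weyl_projective At nabla p x y z =
     (let R = riem At nabla; Ric = ricci R in
        R p x y z + (1 / (real CARD('n) - 1)) *\<^sub>R (Ric p x z *\<^sub>R y - Ric p y z *\<^sub>R x))"

end

theory Submission
  imports Defs
begin

text \<open>Write \<open>D\<close> for the tensor \<open>D3\<close>.  Both \<open>A\<close> and every \<open>R(X,Y)\<close> are skew for \<open>g\<close>, hence
  trace-free, so that \<open>'R4(X,Y) = D(Y, AX)\<close>.  With \<open>A\<^sup>2 = -I\<close> the two terms \<open>'R4(AY,X)AZ\<close> and
  \<open>'R4(AZ,Y)AX\<close> cancel the \<open>D\<close>-terms of \<open>R4\<close>, and
  \<open>Ric4(Y,Z) - 'R4(AY,AZ) = Ric(Y,Z) + (n-1) \<pi>(Y) \<pi>(Z)\<close> removes the terms quadratic in \<open>\<pi>\<close>.\<close>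

section \<open>Calculus of smooth maps\<close>

text \<open>The skewness of R(X,Y) is where analysis enters: X(Y f) and Y(X f) must agree for the
  scalar function f = g(Z,W), so symmetry of second derivatives is proved for
  \<open>smooth_on\<close>. The obstacle is that the tangent space at q is identified with the model
  space by a chart selected for q, which may jump as q moves, so that no derivative can be taken
  before everything is transported to one fixed chart. The fields \<open>ext_vf At p v\<close> meet
  this: near p they are constant-coefficient combinations of the coordinate fields of a single
  chart. Hence they commute at p, the bracket term of \<open>riem\<close> drops out, and derivatives
  along them are partial derivatives. They depend linearly on v only on that chart domain, so
  linearity of the curvature and of \<nabla>\<pi>, without which the traces cannot be evaluated,
  rests on the locality of \<open>nabla\<close> and \<open>dird\<close>.\<close>

lemma differentiable_transform_open:
  assumes "f differentiable (at x)" "open S" "x \<in> S" "\<And>y. y \<in> S \<Longrightarrow> f y = g y"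
  shows "g differentiable (at x)"
  using assms has_derivative_transform_within_open unfolding differentiable_def by blast

text \<open>Openness of S lets equality on S pass to the derivatives at points of S, which keeps the
  induction going. Chart expressions agree only on images of chart domains, so equality everywhere
  is never available.\<close>

lemma Ck_on_cong:
  assumes "open S" "Ck_on k f S" "\<And>x. x \<in> S \<Longrightarrow> f x = g x"
  shows "Ck_on k g S"
  using assms(2,3)
proof (induction k arbitrary: f g)
  case 0
  then show ?case using continuous_on_cong by fastforce
next
  case (Suc k)
  have diff: "f differentiable (at x)" if "x \<in> S" for x
    using Suc.prems that by simp
  then have "\<forall>x\<in>S. g differentiable (at x)"
    using differentiable_transform_open[OF _ \<open>open S\<close>] Suc.prems(2) by blast
  moreover have "Ck_on k (\<lambda>x. frechet_derivative g (at x) v) S" for v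
  proof (rule Suc.IH)
    show "Ck_on k (\<lambda>x. frechet_derivative f (at x) v) S" using Suc.prems by simp
    show "frechet_derivative f (at x) v = frechet_derivative g (at x) v" if "x \<in> S" for x
      by (simp add: frechet_derivative_transform_within_open[OF diff[OF that] \<open>open S\<close> that Suc.prems(2)])
  qed
  ultimately show ?case by simp
qed

lemma Ck_on_subset: "Ck_on k f S \<Longrightarrow> T \<subseteq> S \<Longrightarrow> Ck_on k f T"
  by (induction k arbitrary: f) (auto intro: continuous_on_subset)

lemma Ck_on_lower: "Ck_on (Suc k) f S \<Longrightarrow> Ck_on k f S"
proof (induction k arbitrary: f)
  case 0
  then show ?case
    by (auto intro!: continuous_at_imp_continuous_on differentiable_imp_continuous_within)
next
  case (Suc k)
  from Suc.prems have "\<forall>v. Ck_on (Suc k) (\<lambda>x. frechet_derivative f (at x) v) S"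
    by (subst (asm) Ck_on.simps) blast
  with Suc show ?case by simp
qed

lemma Ck_on_const: "Ck_on k (\<lambda>x. c) S"
  by (induction k arbitrary: c) auto

lemma Ck_on_SucI:
  assumes "open S" "\<And>x. x \<in> S \<Longrightarrow> (f has_derivative f' x) (at x)"
    "\<And>v. Ck_on k (\<lambda>x. f' x v) S"
  shows "Ck_on (Suc k) f S"
proof -
  have "Ck_on k (\<lambda>x. frechet_derivative f (at x) v) S" for v
    by (rule Ck_on_cong[OF assms(1) assms(3)]) (simp add: frechet_derivative_at[OF assms(2), symmetric])
  then show ?thesis using assms(2) by (auto simp: differentiable_def)
qed

lemma Ck_on_SucD:
  assumes "Ck_on (Suc k) f S" "x \<in> S"
  shows "(f has_derivative frechet_derivative f (at x)) (at x)"
  using assms frechet_derivative_works by auto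

lemma Ck_on_add:
  assumes "open S" "Ck_on k f S" "Ck_on k g S"
  shows "Ck_on k (\<lambda>x. f x + g x) S"
  using assms(2,3)
proof (induction k arbitrary: f g)
  case (Suc k)
  show ?case
  proof (rule Ck_on_SucI[OF \<open>open S\<close>])
    show "((\<lambda>x. f x + g x) has_derivative
        (\<lambda>v. frechet_derivative f (at x) v + frechet_derivative g (at x) v)) (at x)" if "x \<in> S" for x
      using Suc.prems that by (intro has_derivative_add Ck_on_SucD)
  qed (use Suc in simp)
qed (auto intro: continuous_on_add)

lemma Ck_on_sum:
  assumes "open S" "\<And>i. i \<in> I \<Longrightarrow> Ck_on k (f i) S"
  shows "Ck_on k (\<lambda>x. \<Sum>i\<in>I. f i x) S"
  using assms(2)
  by (induction I rule: infinite_finite_induct) (auto intro: Ck_on_const Ck_on_add[OF \<open>open S\<close>])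

lemma Ck_on_bounded_linear:
  assumes "open S" "bounded_linear L" "Ck_on k f S"
  shows "Ck_on k (\<lambda>x. L (f x)) S"
  using assms(3)
proof (induction k arbitrary: f)
  case 0
  then show ?case by (simp add: bounded_linear.continuous_on[OF assms(2)])
next
  case (Suc k)
  show ?case
  proof (rule Ck_on_SucI[OF \<open>open S\<close>])
    show "((\<lambda>x. L (f x)) has_derivative (\<lambda>v. L (frechet_derivative f (at x) v))) (at x)"
      if "x \<in> S" for x
      by (rule bounded_linear.has_derivative[OF assms(2) Ck_on_SucD[OF Suc.prems that]])
  qed (use Suc in simp)
qed

lemma Ck_on_scaleR:
  fixes f :: "'a::euclidean_space \<Rightarrow> real"
  assumes "open S" "Ck_on k f S" "Ck_on k g S"
  shows "Ck_on k (\<lambda>x. f x *\<^sub>R g x) S"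
  using assms(2,3)
proof (induction k arbitrary: f g)
  case (Suc k)
  show ?case
  proof (rule Ck_on_SucI[OF \<open>open S\<close>])
    show "((\<lambda>x. f x *\<^sub>R g x) has_derivative
        (\<lambda>v. f x *\<^sub>R frechet_derivative g (at x) v + frechet_derivative f (at x) v *\<^sub>R g x)) (at x)"
      if "x \<in> S" for x
      using Suc.prems that by (intro has_derivative_scaleR Ck_on_SucD)
    have "Ck_on k f S" "Ck_on k g S" using Suc.prems Ck_on_lower by blast+
    then show "Ck_on k (\<lambda>x. f x *\<^sub>R frechet_derivative g (at x) v
        + frechet_derivative f (at x) v *\<^sub>R g x) S" for v
      using Suc.prems by (intro Ck_on_add[OF \<open>open S\<close>] Suc.IH) auto
  qed
qed (auto intro: continuous_on_scaleR)

text \<open>The chain rule applies the derivative of f to a direction that varies with x, whereas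
  \<open>Ck_on\<close> speaks of fixed directions only. Expanding that direction in
  \<open>Basis\<close> gives a sum of products of scalar coefficients with fixed-direction
  derivatives of f composed with g, to which the induction hypothesis applies with the same
  g.\<close>

lemma Ck_on_compose:
  fixes f :: "'b::euclidean_space \<Rightarrow> 'c::real_normed_vector" and g :: "'a::euclidean_space \<Rightarrow> 'b"
  assumes "open S" "g ` S \<subseteq> T" "Ck_on k f T" "Ck_on k g S"
  shows "Ck_on k (f \<circ> g) S"
  using assms(3,4)
proof (induction k arbitrary: f)
  case 0
  then show ?case
    using assms(2) unfolding Ck_on.simps by (blast intro: continuous_on_compose continuous_on_subset)
next
  case (Suc k)
  have lin: "linear (frechet_derivative f (at (g x)))" if "x \<in> S" for x
    using Suc.prems(1) that assms(2) by (auto intro: linear_frechet_derivative)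
  show ?case
  proof (rule Ck_on_SucI[OF \<open>open S\<close>])
    show "(f \<circ> g has_derivative
        (\<lambda>v. \<Sum>i\<in>Basis. (frechet_derivative g (at x) v \<bullet> i) *\<^sub>R frechet_derivative f (at (g x)) i)) (at x)"
      if "x \<in> S" for x
    proof -
      have expand: "frechet_derivative f (at (g x)) w
          = (\<Sum>i\<in>Basis. (w \<bullet> i) *\<^sub>R frechet_derivative f (at (g x)) i)" for w
        using linear_sum[OF lin[OF that], of "\<lambda>i. (w \<bullet> i) *\<^sub>R i" Basis]
        by (simp add: euclidean_representation linear_cmul[OF lin[OF that]])
      have "(f \<circ> g has_derivative frechet_derivative f (at (g x)) \<circ> frechet_derivative g (at x)) (at x)"
        using Suc.prems assms(2) that by (intro diff_chain_at Ck_on_SucD) auto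
      moreover have "frechet_derivative f (at (g x)) \<circ> frechet_derivative g (at x) = (\<lambda>v. \<Sum>i\<in>Basis.
          (frechet_derivative g (at x) v \<bullet> i) *\<^sub>R frechet_derivative f (at (g x)) i)"
        unfolding o_def by (rule ext) (rule expand)
      ultimately show ?thesis by (simp only:)
    qed
    fix v
    have "Ck_on k ((\<lambda>y. frechet_derivative f (at y) i) \<circ> g) S" for i
      using Suc.prems Ck_on_lower by (intro Suc.IH) auto
    moreover have "Ck_on k (\<lambda>x. frechet_derivative g (at x) v \<bullet> i) S" for i
      using Suc.prems by (intro Ck_on_bounded_linear[OF \<open>open S\<close> bounded_linear_inner_left]) auto
    ultimately show "Ck_on k (\<lambda>x. \<Sum>i\<in>Basis.
        (frechet_derivative g (at x) v \<bullet> i) *\<^sub>R frechet_derivative f (at (g x)) i) S"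
      by (intro Ck_on_sum Ck_on_scaleR \<open>open S\<close>) (auto simp: o_def)
  qed
qed

lemma smooth_on_cong:
  "open S \<Longrightarrow> smooth_on f S \<Longrightarrow> (\<And>x. x \<in> S \<Longrightarrow> f x = g x) \<Longrightarrow> smooth_on g S"
  unfolding smooth_on_def using Ck_on_cong by blast

lemma smooth_on_subset: "smooth_on f S \<Longrightarrow> T \<subseteq> S \<Longrightarrow> smooth_on f T"
  unfolding smooth_on_def using Ck_on_subset by blast

lemma smooth_on_const: "smooth_on (\<lambda>x. c) S"
  by (simp add: smooth_on_def Ck_on_const)

lemma smooth_on_add:
  "open S \<Longrightarrow> smooth_on f S \<Longrightarrow> smooth_on g S \<Longrightarrow> smooth_on (\<lambda>x. f x + g x) S"
  unfolding smooth_on_def using Ck_on_add by blast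

lemma smooth_on_compose:
  assumes "open S" "g ` S \<subseteq> T" "smooth_on f T" "smooth_on g S"
  shows "smooth_on (f \<circ> g) S"
  using assms Ck_on_compose unfolding smooth_on_def by blast

lemma smooth_on_derivative: "smooth_on f S \<Longrightarrow> smooth_on (\<lambda>x. frechet_derivative f (at x) v) S"
  unfolding smooth_on_def using Ck_on.simps(2) by blast

lemma smooth_on_differentiable: "smooth_on f S \<Longrightarrow> x \<in> S \<Longrightarrow> f differentiable (at x)"
  unfolding smooth_on_def using Ck_on.simps(2) by blast

lemma smooth_on_continuous: "smooth_on f S \<Longrightarrow> continuous_on S f"
  unfolding smooth_on_def using Ck_on.simps(1) by blast

section \<open>Symmetry of second derivatives\<close>

text \<open>The mean value theorem is used twice: along u for the increment of f in direction v,
  then along v for the derivative of f in direction u. The bound on t keeps the whole parallelogram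
  inside the ball.\<close>

lemma second_difference_mean_value:
  fixes f :: "'a::euclidean_space \<Rightarrow> real"
  assumes f: "smooth_on f (ball a d)" and t: "0 < t" "t * (norm u + norm v) < d"
  shows "\<exists>p\<in>ball a d. f (a + t *\<^sub>R u + t *\<^sub>R v) - f (a + t *\<^sub>R u) - f (a + t *\<^sub>R v) + f a
     = t\<^sup>2 * frechet_derivative (\<lambda>x. frechet_derivative f (at x) u) (at p) v"
proof -
  define G where "G = (\<lambda>x. frechet_derivative f (at x) u)"
  have mem: "a + s *\<^sub>R u + r *\<^sub>R v \<in> ball a d" if "0 \<le> s" "s \<le> t" "0 \<le> r" "r \<le> t" for s r
  proof -
    have "norm (s *\<^sub>R u + r *\<^sub>R v) \<le> s * norm u + r * norm v"
      using that norm_triangle_ineq[of "s *\<^sub>R u" "r *\<^sub>R v"] by simp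
    also have "\<dots> \<le> t * (norm u + norm v)"
      using that by (simp add: distrib_left add_mono mult_right_mono)
    also have "\<dots> < d" by fact
    finally have "norm (s *\<^sub>R u + r *\<^sub>R v) < d" .
    moreover have "dist a (a + w) = norm w" for w by (simp add: dist_norm)
    ultimately show ?thesis by (simp only: mem_ball add.assoc)
  qed
  have line: "((\<lambda>s. h (c + s *\<^sub>R w)) has_real_derivative frechet_derivative h (at (c + s *\<^sub>R w)) w) (at s)"
    if h: "smooth_on h (ball a d)" and m: "c + s *\<^sub>R w \<in> ball a d"
    for h :: "'a \<Rightarrow> real" and c s w
  proof -
    have "(h has_derivative frechet_derivative h (at (c + s *\<^sub>R w))) (at (c + s *\<^sub>R w))"
      using smooth_on_differentiable[OF h m] frechet_derivative_works by blast
    moreover have "((\<lambda>s. c + s *\<^sub>R w) has_derivative (\<lambda>k. k *\<^sub>R w)) (at s)"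
      by (auto intro!: derivative_eq_intros)
    ultimately have "((\<lambda>s. h (c + s *\<^sub>R w)) has_derivative
        (\<lambda>k. frechet_derivative h (at (c + s *\<^sub>R w)) (k *\<^sub>R w))) (at s)"
      using diff_chain_at[of "\<lambda>s. c + s *\<^sub>R w" "\<lambda>k. k *\<^sub>R w" s h] by (simp add: o_def)
    moreover have "linear (frechet_derivative h (at (c + s *\<^sub>R w)))"
      using smooth_on_differentiable[OF h m] linear_frechet_derivative by blast
    ultimately show ?thesis
      by (simp add: has_field_derivative_def linear_cmul mult_commute_abs)
  qed
  define \<phi> where "\<phi> = (\<lambda>s. f ((a + t *\<^sub>R v) + s *\<^sub>R u) - f (a + s *\<^sub>R u))"
  have "(\<phi> has_real_derivative G ((a + t *\<^sub>R v) + s *\<^sub>R u) - G (a + s *\<^sub>R u)) (at s)"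
    if "0 \<le> s" "s \<le> t" for s
    unfolding \<phi>_def G_def using mem[of s t] mem[of s 0] that t
    by (intro DERIV_diff line[OF f]) (simp_all add: algebra_simps)
  from MVT2[OF t(1) this] obtain s where s: "0 < s" "s < t"
    and 1: "\<phi> t - \<phi> 0 = t * (G ((a + t *\<^sub>R v) + s *\<^sub>R u) - G (a + s *\<^sub>R u))" by auto
  have "((\<lambda>r. G ((a + s *\<^sub>R u) + r *\<^sub>R v)) has_real_derivative
      frechet_derivative G (at ((a + s *\<^sub>R u) + r *\<^sub>R v)) v) (at r)" if "0 \<le> r" "r \<le> t" for r
    unfolding G_def using mem[of s r] that s by (intro line smooth_on_derivative[OF f]) auto
  from MVT2[OF t(1) this] obtain r where r: "0 < r" "r < t"
    and 2: "G (a + s *\<^sub>R u + t *\<^sub>R v) - G (a + s *\<^sub>R u)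
      = t * frechet_derivative G (at (a + s *\<^sub>R u + r *\<^sub>R v)) v" by auto
  have "f (a + t *\<^sub>R u + t *\<^sub>R v) - f (a + t *\<^sub>R u) - f (a + t *\<^sub>R v) + f a = \<phi> t - \<phi> 0"
    by (simp add: \<phi>_def algebra_simps)
  also have "\<dots> = t\<^sup>2 * frechet_derivative G (at (a + s *\<^sub>R u + r *\<^sub>R v)) v"
    using 1 2 by (simp add: power2_eq_square algebra_simps)
  finally show ?thesis
    using mem[of s r] s r unfolding G_def by auto
qed

text \<open>The second difference does not change when u and v are swapped. Its two mean value forms
  therefore give equal values of the two mixed derivatives at points p and q close to a, and
  continuity at a carries the equality to a up to e/2 + e/2.\<close>

lemma symmetric_second_derivative:
  fixes f :: "'a::euclidean_space \<Rightarrow> real"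
  assumes "open S" "smooth_on f S" "a \<in> S"
  shows "frechet_derivative (\<lambda>x. frechet_derivative f (at x) u) (at a) v
       = frechet_derivative (\<lambda>x. frechet_derivative f (at x) v) (at a) u"
proof -
  define G where "G = (\<lambda>u v p. frechet_derivative (\<lambda>x. frechet_derivative f (at x) u) (at p) v)"
  have cont: "isCont (G u v) a" for u v
    unfolding G_def using assms
    by (intro continuous_on_interior[of S] smooth_on_continuous smooth_on_derivative)
       (auto simp: interior_open)
  have "\<bar>G u v a - G v u a\<bar> \<le> e" if "e > 0" for e
  proof -
    have "\<forall>\<^sub>F p in nhds a. dist (G u v p) (G u v a) < e/2" for u v
    proof (rule tendstoD)
      show "(G u v \<longlongrightarrow> G u v a) (nhds a)"
        using cont[of u v] by (simp only: isCont_def tendsto_at_iff_tendsto_nhds)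
    qed (use \<open>e > 0\<close> in simp)
    then have "\<forall>\<^sub>F p in nhds a. dist (G u v p) (G u v a) < e/2 \<and> dist (G v u p) (G v u a) < e/2 \<and> p \<in> S"
      using assms(1,3) by (intro eventually_conj eventually_nhds_in_open)
    then obtain d where d: "d > 0" and
      *: "\<And>p. p \<in> ball a d \<Longrightarrow> dist (G u v p) (G u v a) < e/2 \<and> dist (G v u p) (G v u a) < e/2 \<and> p \<in> S"
      unfolding eventually_nhds_metric by (auto simp: dist_commute)
    \<comment> \<open>The summand 1 keeps N positive when u = v = 0; the factor 2 leaves room for
      the strict bound, since t (|u| + |v|) is at most d/2.\<close>
    define N t where "N = norm u + norm v + 1" and "t = d / (2 * N)"
    then have N: "N > 0" by (simp add: add_nonneg_pos)
    then have t: "0 < t" using d by (simp add: t_def)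
    have "t * (norm u + norm v) \<le> t * N"
      using t by (intro mult_left_mono) (auto simp: N_def)
    also have "\<dots> = d / 2" using N by (simp add: t_def)
    finally have t: "0 < t" "t * (norm u + norm v) < d" using d t by auto
    have f: "smooth_on f (ball a d)" using * by (auto intro: smooth_on_subset[OF assms(2)])
    obtain p where p: "p \<in> ball a d"
      "f (a + t *\<^sub>R u + t *\<^sub>R v) - f (a + t *\<^sub>R u) - f (a + t *\<^sub>R v) + f a = t\<^sup>2 * G u v p"
      using second_difference_mean_value[OF f t] unfolding G_def by blast
    obtain q where q: "q \<in> ball a d"
      "f (a + t *\<^sub>R v + t *\<^sub>R u) - f (a + t *\<^sub>R v) - f (a + t *\<^sub>R u) + f a = t\<^sup>2 * G v u q"
      using second_difference_mean_value[OF f t(1), of v u] t(2) unfolding G_def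
      by (auto simp: add.commute)
    have "t\<^sup>2 * G u v p = t\<^sup>2 * G v u q" using p(2) q(2) by (simp add: algebra_simps)
    then have "G u v p = G v u q" using t by simp
    moreover have "\<bar>G u v p - G u v a\<bar> < e/2" "\<bar>G v u q - G v u a\<bar> < e/2"
      using *[OF p(1)] *[OF q(1)] by (simp_all only: dist_real_def)
    ultimately show ?thesis by linarith
  qed
  then have "G u v a = G v u a" using field_le_epsilon[of "\<bar>G u v a - G v u a\<bar>" 0] by fastforce
  then show ?thesis by (simp add: G_def)
qed

section \<open>Charts and coordinate vector fields\<close>

locale smooth_manifold =
  fixes At :: "('m::{t2_space, second_countable_topology}, 'n::finite) chart set"
  assumes atlas: "smooth_atlas At"
begin

lemma chart_at_in: "chart_at At p \<in> At" and mem_chart_at: "p \<in> cdom (chart_at At p)"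
proof -
  have "\<exists>c. c \<in> At \<and> p \<in> cdom c"
    using atlas unfolding smooth_atlas_def by blast
  then have "chart_at At p \<in> At \<and> p \<in> cdom (chart_at At p)"
    unfolding chart_at_def by (rule someI_ex)
  then show "chart_at At p \<in> At" "p \<in> cdom (chart_at At p)" by auto
qed

lemma chart: "c \<in> At \<Longrightarrow> is_chart c"
  using atlas by (simp add: smooth_atlas_def)

lemma open_cdom: "c \<in> At \<Longrightarrow> open (cdom c)"
  using chart by (auto simp: is_chart_def)

lemma cinv_cmap [simp]: "c \<in> At \<Longrightarrow> q \<in> cdom c \<Longrightarrow> cinv c (cmap c q) = q"
  using chart[of c] unfolding is_chart_def by (auto simp: homeomorphism_apply1)

lemma open_cmap_image:
  assumes "c \<in> At" "open V"
  shows "open (cmap c ` (V \<inter> cdom c))"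
proof -
  have "homeomorphism (cdom c) (cmap c ` cdom c) (cmap c) (cinv c)" "open (cmap c ` cdom c)"
    using chart[OF assms(1)] by (auto simp: is_chart_def)
  moreover have "openin (top_of_set (cdom c)) (V \<inter> cdom c)"
    using assms(2) by (auto simp: openin_open Int_commute)
  ultimately show ?thesis
    using homeomorphism_imp_open_map openin_open_trans by blast
qed

lemma smooth_transition:
  "c \<in> At \<Longrightarrow> d \<in> At \<Longrightarrow> smooth_on (cmap d \<circ> cinv c) (cmap c ` (cdom c \<inter> cdom d))"
  using atlas by (auto simp: smooth_atlas_def)

lemma differentiable_transition:
  assumes "c \<in> At" "d \<in> At" "q \<in> cdom c" "q \<in> cdom d"
  shows "(cmap d \<circ> cinv c) differentiable (at (cmap c q))"
  using assms by (intro smooth_on_differentiable[OF smooth_transition]) auto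

section \<open>Changes of chart\<close>

text \<open>Near the point, \<open>f \<circ> cinv c\<close> factors through the transition map, so
  this is the chain rule. Taking f to be a coordinate map gives the cocycle rule for components of
  vectors; taking it real gives the chart independence of \<open>dird\<close>.\<close>

lemma frechet_derivative_change_chart:
  fixes f :: "'m \<Rightarrow> 'b::real_normed_vector"
  assumes c: "c \<in> At" "q \<in> cdom c" and d: "d \<in> At" "q \<in> cdom d"
    and f: "(f \<circ> cinv d) differentiable (at (cmap d q))"
  shows "frechet_derivative (f \<circ> cinv d) (at (cmap d q))
      (frechet_derivative (cmap d \<circ> cinv c) (at (cmap c q)) v)
    = frechet_derivative (f \<circ> cinv c) (at (cmap c q)) v"
proof -
  let ?t = "cmap d \<circ> cinv c"
  have t: "?t differentiable (at (cmap c q))" by (rule differentiable_transition) fact+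
  have tq: "?t (cmap c q) = cmap d q" using c by simp
  have comp: "((f \<circ> cinv d) \<circ> ?t) differentiable (at (cmap c q))"
    using t f tq by (intro differentiable_chain_at) auto
  have "frechet_derivative ((f \<circ> cinv d) \<circ> ?t) (at (cmap c q))
      = frechet_derivative (f \<circ> cinv c) (at (cmap c q))"
  proof (rule frechet_derivative_transform_within_open[OF comp])
    show "open (cmap c ` (cdom d \<inter> cdom c))"
      using c d by (intro open_cmap_image open_cdom)
    show "cmap c q \<in> cmap c ` (cdom d \<inter> cdom c)" using c d by auto
    show "((f \<circ> cinv d) \<circ> ?t) x = (f \<circ> cinv c) x" if "x \<in> cmap c ` (cdom d \<inter> cdom c)" for x
      using that c d by auto
  qed
  moreover have "frechet_derivative ((f \<circ> cinv d) \<circ> ?t) (at (cmap c q))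
      = frechet_derivative (f \<circ> cinv d) (at (cmap d q)) \<circ> frechet_derivative ?t (at (cmap c q))"
    using frechet_derivative_compose[OF t] f tq by simp
  ultimately show ?thesis by (simp add: fun_eq_iff)
qed

lemma frechet_derivative_identity_transition:
  assumes "c \<in> At" "q \<in> cdom c"
  shows "frechet_derivative (cmap c \<circ> cinv c) (at (cmap c q)) v = v"
proof -
  have "frechet_derivative (cmap c \<circ> cinv c) (at (cmap c q)) = frechet_derivative (\<lambda>x. x) (at (cmap c q))"
  proof (rule frechet_derivative_transform_within_open)
    show "(cmap c \<circ> cinv c) differentiable (at (cmap c q))"
      using assms by (intro differentiable_transition)
    show "open (cmap c ` (UNIV \<inter> cdom c))" using assms by (intro open_cmap_image) auto
  qed (use assms in auto)
  then show ?thesis by simp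
qed

text \<open>The chart selected at q cancels between \<open>tcoord\<close> and \<open>tvec\<close>.
  What remains involves only c and the chart at p, so the field is smooth even though the selected
  chart jumps with q.\<close>

lemma vf_rep_ext_vf:
  assumes c: "c \<in> At" "q \<in> cdom c" and q: "q \<in> cdom (chart_at At p)"
  shows "vf_rep At c (ext_vf At p v) (cmap c q)
    = frechet_derivative (cmap c \<circ> cinv (chart_at At p)) (at (cmap (chart_at At p) q)) v"
  using frechet_derivative_change_chart[OF chart_at_in q chart_at_in mem_chart_at
      differentiable_transition[OF chart_at_in c(1) mem_chart_at c(2)]] c
  by (simp add: vf_rep_def ext_vf_def tcoord_def tvec_def)

lemma ext_vf_base [simp]: "ext_vf At p v p = v"
  by (simp add: ext_vf_def tvec_def frechet_derivative_identity_transition chart_at_in mem_chart_at)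

lemma smooth_ext_vf: "smooth_vf At (cdom (chart_at At p)) (ext_vf At p v)"
  unfolding smooth_vf_def
proof
  fix c assume c: "c \<in> At"
  let ?e = "chart_at At p"
  let ?S = "cmap c ` (cdom ?e \<inter> cdom c)"
  have S: "open ?S" using c chart_at_in by (intro open_cmap_image open_cdom)
  have "smooth_on ((\<lambda>y. frechet_derivative (cmap c \<circ> cinv ?e) (at y) v) \<circ> (cmap ?e \<circ> cinv c)) ?S"
  proof (rule smooth_on_compose[OF S])
    show "smooth_on (\<lambda>y. frechet_derivative (cmap c \<circ> cinv ?e) (at y) v) (cmap ?e ` (cdom ?e \<inter> cdom c))"
      using c chart_at_in by (intro smooth_on_derivative smooth_transition)
    show "smooth_on (cmap ?e \<circ> cinv c) ?S"
      using smooth_transition[OF c chart_at_in] by (simp add: Int_commute)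
  qed (use c in auto)
  then show "smooth_on (vf_rep At c (ext_vf At p v)) ?S"
    by (rule smooth_on_cong[OF S]) (use c in \<open>auto simp: vf_rep_ext_vf\<close>)
qed

lemma smooth_vf_cong:
  assumes "open U" "smooth_vf At U Y" "\<And>q. q \<in> U \<Longrightarrow> Y q = Z q"
  shows "smooth_vf At U Z"
  unfolding smooth_vf_def
proof
  fix c assume c: "c \<in> At"
  show "smooth_on (vf_rep At c Z) (cmap c ` (U \<inter> cdom c))"
    by (rule smooth_on_cong[OF open_cmap_image[OF c \<open>open U\<close>], of "vf_rep At c Y"])
      (use assms c in \<open>auto simp: smooth_vf_def vf_rep_def\<close>)
qed

text \<open>In the chart at p both fields have constant components near p, so both derivatives in
  the coordinate expression of the bracket vanish.\<close>

lemma lie_bracket_ext_vf: "lie_bracket At (ext_vf At p x) (ext_vf At p y) p = 0"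
proof -
  let ?c = "chart_at At p"
  have "frechet_derivative (\<lambda>_. v) (at (cmap ?c p)) = frechet_derivative (vf_rep At ?c (ext_vf At p v)) (at (cmap ?c p))" for v
  proof (rule frechet_derivative_transform_within_open)
    show "open (cmap ?c ` (UNIV \<inter> cdom ?c))" using chart_at_in by (intro open_cmap_image) auto
  qed (use mem_chart_at chart_at_in in
      \<open>auto simp: vf_rep_ext_vf frechet_derivative_identity_transition\<close>)
  then have "frechet_derivative (vf_rep At ?c (ext_vf At p v)) (at (cmap ?c p)) = (\<lambda>_. 0)" for v
    by (metis frechet_derivative_const)
  then show ?thesis by (simp add: lie_bracket_def)
qed

section \<open>Smooth functions and their derivatives along tangent vectors\<close>

lemma smooth_fun_differentiable:
  assumes "smooth_fun At U f" "c \<in> At" "q \<in> U" "q \<in> cdom c"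
  shows "(f \<circ> cinv c) differentiable (at (cmap c q))"
  using assms unfolding smooth_fun_def by (auto intro: smooth_on_differentiable)

text \<open>Constancy is asked on U only, so that the indicator function of U is covered, whatever
  its behaviour at the boundary; \<open>nabla_local\<close> relies on this.\<close>

lemma smooth_fun_const_on:
  assumes "open U" "\<And>q. q \<in> U \<Longrightarrow> f q = k"
  shows "smooth_fun At U f"
  unfolding smooth_fun_def
proof
  fix c assume c: "c \<in> At"
  show "smooth_on (f \<circ> cinv c) (cmap c ` (U \<inter> cdom c))"
    by (rule smooth_on_cong[OF open_cmap_image[OF c \<open>open U\<close>] smooth_on_const[of k]])
      (use assms c in auto)
qed

lemma smooth_fun_add:
  assumes "open U" "smooth_fun At U f" "smooth_fun At U h"
  shows "smooth_fun At U (\<lambda>q. f q + h q)"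
  unfolding smooth_fun_def
proof
  fix c assume c: "c \<in> At"
  have "smooth_on (\<lambda>x. (f \<circ> cinv c) x + (h \<circ> cinv c) x) (cmap c ` (U \<inter> cdom c))"
    using assms c by (intro smooth_on_add open_cmap_image) (auto simp: smooth_fun_def simp del: o_apply)
  then show "smooth_on ((\<lambda>q. f q + h q) \<circ> cinv c) (cmap c ` (U \<inter> cdom c))"
    by (simp add: o_def)
qed

lemma dird_cong:
  assumes "open U" "smooth_fun At U f" "p \<in> U" "\<And>q. q \<in> U \<Longrightarrow> f q = h q"
  shows "dird At f p v = dird At h p v"
proof -
  let ?c = "chart_at At p"
  have "frechet_derivative (f \<circ> cinv ?c) (at (cmap ?c p)) = frechet_derivative (h \<circ> cinv ?c) (at (cmap ?c p))"
    by (rule frechet_derivative_transform_within_open[of _ _ "cmap ?c ` (U \<inter> cdom ?c)"])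
      (use assms in \<open>auto intro!: smooth_fun_differentiable open_cmap_image chart_at_in mem_chart_at simp: chart_at_in\<close>)
  then show ?thesis by (simp add: dird_def)
qed

lemma dird_const_on:
  assumes "open U" "p \<in> U" "\<And>q. q \<in> U \<Longrightarrow> f q = k"
  shows "dird At f p v = 0"
proof -
  have "dird At f p v = dird At (\<lambda>_. k) p v"
    using assms by (intro dird_cong smooth_fun_const_on)
  then show ?thesis by (simp add: dird_def o_def)
qed

lemma linear_dird:
  assumes "smooth_fun At U f" "p \<in> U"
  shows "linear (dird At f p)"
  unfolding dird_def
  using assms by (intro linear_frechet_derivative smooth_fun_differentiable chart_at_in mem_chart_at)

lemma dird_add:
  assumes "smooth_fun At U f" "smooth_fun At U h" "p \<in> U"
  shows "dird At (\<lambda>q. f q + h q) p v = dird At f p v + dird At h p v"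
proof -
  let ?c = "chart_at At p"
  have d: "(f \<circ> cinv ?c) differentiable (at (cmap ?c p))" "(h \<circ> cinv ?c) differentiable (at (cmap ?c p))"
    using assms by (auto intro!: smooth_fun_differentiable chart_at_in mem_chart_at)
  have "((\<lambda>x. (f \<circ> cinv ?c) x + (h \<circ> cinv ?c) x) has_derivative
      (\<lambda>v. frechet_derivative (f \<circ> cinv ?c) (at (cmap ?c p)) v
         + frechet_derivative (h \<circ> cinv ?c) (at (cmap ?c p)) v)) (at (cmap ?c p))"
    using d unfolding frechet_derivative_works by (rule has_derivative_add)
  from frechet_derivative_at[OF this, symmetric] show ?thesis
    by (simp add: dird_def o_def)
qed

lemma dird_cmult:
  assumes "smooth_fun At U f" "p \<in> U"
  shows "dird At (\<lambda>q. k * f q) p v = k * dird At f p v"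
proof -
  let ?c = "chart_at At p"
  have d: "(f \<circ> cinv ?c) differentiable (at (cmap ?c p))"
    using assms by (auto intro!: smooth_fun_differentiable chart_at_in mem_chart_at)
  have "((\<lambda>x. k * (f \<circ> cinv ?c) x) has_derivative
      (\<lambda>v. k * frechet_derivative (f \<circ> cinv ?c) (at (cmap ?c p)) v)) (at (cmap ?c p))"
    using d unfolding frechet_derivative_works by (rule has_derivative_mult_right)
  from frechet_derivative_at[OF this, symmetric] show ?thesis
    by (simp add: dird_def o_def)
qed

text \<open>Along \<open>ext_vf\<close> the chart selected at q disappears and a directional
  derivative in the one chart at p is left. This makes a second differentiation possible.\<close>

lemma dird_ext_vf:
  assumes "smooth_fun At U f" "q \<in> U" "q \<in> cdom (chart_at At p)"
  shows "dird At f q (ext_vf At p v q)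
    = frechet_derivative (f \<circ> cinv (chart_at At p)) (at (cmap (chart_at At p) q)) v"
  unfolding dird_def ext_vf_def tvec_def
  using assms by (intro frechet_derivative_change_chart chart_at_in mem_chart_at smooth_fun_differentiable)

text \<open>Coordinate vector fields commute, so this is the equality of mixed partial derivatives.\<close>

lemma dird_ext_vf_commute:
  assumes U: "open U" and f: "smooth_fun At U f" and p: "p \<in> U"
  shows "dird At (\<lambda>q. dird At f q (ext_vf At p y q)) p x = dird At (\<lambda>q. dird At f q (ext_vf At p x q)) p y"
proof -
  let ?c = "chart_at At p"
  let ?S = "cmap ?c ` (U \<inter> cdom ?c)"
  let ?f = "f \<circ> cinv ?c"
  have S: "open ?S" using U chart_at_in by (rule open_cmap_image[rotated])
  have pS: "cmap ?c p \<in> ?S" using p mem_chart_at by auto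
  have fS: "smooth_on ?f ?S" using f chart_at_in by (auto simp: smooth_fun_def)
  have "dird At (\<lambda>q. dird At f q (ext_vf At p y q)) p x
      = frechet_derivative (\<lambda>u. frechet_derivative ?f (at u) y) (at (cmap ?c p)) x" for x y
  proof -
    have "frechet_derivative (\<lambda>u. frechet_derivative ?f (at u) y) (at (cmap ?c p))
        = frechet_derivative ((\<lambda>q. dird At f q (ext_vf At p y q)) \<circ> cinv ?c) (at (cmap ?c p))"
    proof (rule frechet_derivative_transform_within_open[OF _ S pS])
      show "(\<lambda>u. frechet_derivative ?f (at u) y) differentiable (at (cmap ?c p))"
        by (rule smooth_on_differentiable[OF smooth_on_derivative[OF fS] pS])
    qed (use f chart_at_in in \<open>auto simp: dird_ext_vf\<close>)
    then show ?thesis by (simp add: dird_def[of At "\<lambda>q. dird At f q (ext_vf At p y q)"])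
  qed
  then show ?thesis using symmetric_second_derivative[OF S fS pS] by simp
qed

text \<open>Off the chart domain the transition map need not be differentiable, so additivity is
  local and is combined below with \<open>nabla_local\<close> and \<open>dird_cong\<close>.\<close>

lemma ext_vf_add:
  assumes "q \<in> cdom (chart_at At p)"
  shows "ext_vf At p (v + w) q = ext_vf At p v q + ext_vf At p w q"
  unfolding ext_vf_def tvec_def using assms
  by (intro linear_add linear_frechet_derivative differentiable_transition chart_at_in mem_chart_at)

lemma ext_vf_scaleR:
  assumes "q \<in> cdom (chart_at At p)"
  shows "ext_vf At p (k *\<^sub>R v) q = k *\<^sub>R ext_vf At p v q"
  unfolding ext_vf_def tvec_def using assms
  by (intro linear_cmul linear_frechet_derivative differentiable_transition chart_at_in mem_chart_at)

end

section \<open>Traces\<close>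

lemma trace_matrix: "trace (matrix f) = (\<Sum>i\<in>UNIV. f (axis i 1) $ i)"
  by (simp add: trace_def matrix_def)

lemma trace_matrix_add: "trace (matrix (\<lambda>x. f x + h x)) = trace (matrix f) + trace (matrix h)"
  by (simp add: trace_matrix sum.distrib)

lemma trace_matrix_diff:
  fixes f :: "real ^ 'n \<Rightarrow> real ^ 'n"
  shows "trace (matrix (\<lambda>x. f x - h x)) = trace (matrix f) - trace (matrix h)"
  by (simp add: trace_matrix sum_subtractf)

lemma trace_matrix_scaleR:
  fixes f :: "real ^ 'n \<Rightarrow> real ^ 'n"
  shows "trace (matrix (\<lambda>x. k *\<^sub>R f x)) = k * trace (matrix f)"
  by (simp add: trace_matrix sum_distrib_left)

lemma trace_matrix_ident: "trace (matrix (\<lambda>x::real^'n. x)) = real CARD('n)"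
  by (simp add: trace_matrix axis_def)

lemma trace_matrix_rank_one:
  fixes \<phi> :: "real ^ 'n \<Rightarrow> real"
  assumes "linear \<phi>"
  shows "trace (matrix (\<lambda>x. \<phi> x *\<^sub>R w)) = \<phi> w"
proof -
  have "\<phi> w = \<phi> (\<Sum>i\<in>UNIV. (w $ i) *\<^sub>R axis i 1)"
    by (simp add: basis_expansion flip: scalar_mult_eq_scaleR)
  also have "\<dots> = (\<Sum>i\<in>UNIV. (w $ i) * \<phi> (axis i 1))"
    by (simp add: linear_sum[OF assms] linear_cmul[OF assms])
  finally show ?thesis by (simp add: trace_matrix mult.commute)
qed

text \<open>In terms of the Gram matrix \<open>G\<close> of \<open>b\<close>, skewness of \<open>M\<close> reads \<open>M\<^sup>T G = - G M\<close>, so that \<open>M\<close> is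
  similar to \<open>- M\<^sup>T\<close>.\<close>

lemma trace_skew:
  fixes b :: "real ^ 'n \<Rightarrow> real ^ 'n \<Rightarrow> real"
  assumes b: "bilinear b" "\<And>v. v \<noteq> 0 \<Longrightarrow> b v v > 0"
    and L: "linear L" and skew: "\<And>v w. b (L v) w = - b v (L w)"
  shows "trace (matrix L) = 0"
proof -
  define G :: "real ^ 'n ^ 'n" where "G = (\<chi> i j. b (axis i 1) (axis j 1))"
  let ?M = "matrix L"
  have left: "linear (\<lambda>v. b v w)" and right: "linear (b w)" for w
    using b(1) by (auto simp: bilinear_def)
  have expand: "v = (\<Sum>i\<in>UNIV. (v $ i) *\<^sub>R axis i 1)" for v :: "real ^ 'n"
    by (simp add: basis_expansion flip: scalar_mult_eq_scaleR)
  have Gr: "(\<Sum>k\<in>UNIV. b u (axis k 1) * (v $ k)) = b u v" for u v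
    by (subst (2) expand[of v]) (simp add: linear_sum[OF right] linear_cmul[OF right] mult.commute)
  have Gl: "(\<Sum>k\<in>UNIV. (v $ k) * b (axis k 1) u) = b v u" for u v
    by (subst (2) expand[of v]) (simp add: linear_sum[OF left] linear_cmul[OF left])
  have GM: "G ** ?M = (- 1) *\<^sub>R (transpose ?M ** G)"
    by (simp add: vec_eq_iff matrix_matrix_mult_def transpose_def matrix_def G_def Gr Gl skew)
  \<comment> \<open>Definiteness of b enters here: a vector v in the kernel of G has b(v,v) = 0,
    hence v = 0.\<close>
  have "invertible G"
  proof -
    have "v = 0" if "G *v v = 0" for v
    proof (rule ccontr)
      assume "v \<noteq> 0"
      have "b v v = (\<Sum>i\<in>UNIV. (v $ i) * (G *v v) $ i)"
        by (simp add: matrix_vector_mult_def G_def Gr Gl)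
      then show False using b(2)[OF \<open>v \<noteq> 0\<close>] that by simp
    qed
    then show ?thesis
      unfolding invertible_left_inverse matrix_left_invertible_ker by blast
  qed
  then obtain G' where G': "G ** G' = mat 1" "G' ** G = mat 1" by (auto simp: invertible_def)
  have "trace ?M = trace (G' ** (G ** ?M))" by (simp add: matrix_mul_assoc G')
  also have "\<dots> = trace ((G ** ?M) ** G')" by (rule trace_mul_sym)
  also note GM
  also have "(- 1) *\<^sub>R (transpose ?M ** G) ** G' = (- 1) *\<^sub>R (transpose ?M ** (G ** G'))"
    by (simp only: scalar_matrix_assoc matrix_mul_assoc)
  finally have "trace ?M = - trace (transpose ?M)" by (simp add: G' trace_def sum_negf)
  then show ?thesis by (simp add: trace_def transpose_def)
qed

section \<open>Connections and curvature\<close>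

locale manifold_with_connection = smooth_manifold At
  for At :: "('m::{t2_space, second_countable_topology}, 'n::finite) chart set" +
  fixes nabla :: "('m, 'n) conn"
  assumes connection: "affine_connection At nabla"
begin

lemmas connectionD =
  connection[unfolded affine_connection_def, THEN spec, THEN spec, THEN mp, OF conjI]

lemma linear_nabla:
  assumes "open U" "smooth_vf At U Y" "p \<in> U"
  shows "linear (\<lambda>v. nabla p v Y)"
  using connectionD[OF assms(1,2), THEN conjunct1] assms(3) by (rule bspec)

lemma smooth_nabla:
  assumes "open U" "smooth_vf At U X" "smooth_vf At U Y"
  shows "smooth_vf At U (\<lambda>p. nabla p (X p) Y)"
  using connectionD[OF assms(1,3), THEN conjunct2, THEN conjunct1] assms(2) by (elim allE impE)

lemma nabla_add:
  assumes "open U" "smooth_vf At U Y" "smooth_vf At U Z" "p \<in> U"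
  shows "nabla p v (\<lambda>q. Y q + Z q) = nabla p v Y + nabla p v Z"
  using connectionD[OF assms(1,2), THEN conjunct2, THEN conjunct2, THEN conjunct1,
      THEN spec, THEN mp, OF assms(3)] assms(4) by simp

lemma nabla_leibniz:
  assumes "open U" "smooth_vf At U Y" "smooth_fun At U f" "p \<in> U"
  shows "nabla p v (\<lambda>q. f q *\<^sub>R Y q) = dird At f p v *\<^sub>R Y p + f p *\<^sub>R nabla p v Y"
  using connectionD[OF assms(1,2), THEN conjunct2, THEN conjunct2, THEN conjunct2,
      THEN spec, THEN mp, OF assms(3)] assms(4) by simp

text \<open>Real homogeneity is the Leibniz rule for a constant function, whose derivative
  vanishes.\<close>

lemma nabla_scaleR:
  assumes "open U" "smooth_vf At U Y" "p \<in> U"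
  shows "nabla p v (\<lambda>q. k *\<^sub>R Y q) = k *\<^sub>R nabla p v Y"
  using nabla_leibniz[OF assms(1,2) smooth_fun_const_on[OF assms(1), of "\<lambda>_. k"] assms(3)]
    dird_const_on[OF assms(1,3), of "\<lambda>_. k" k] by simp

text \<open>Multiplication with the indicator function of \<open>U\<close> makes \<open>Y\<close> and \<open>Z\<close> equal everywhere.\<close>

lemma nabla_local:
  assumes U: "open U" and Y: "smooth_vf At U Y" and p: "p \<in> U" and eq: "\<And>q. q \<in> U \<Longrightarrow> Y q = Z q"
  shows "nabla p v Y = nabla p v Z"
proof -
  let ?f = "\<lambda>q. if q \<in> U then 1 else 0 :: real"
  have f: "smooth_fun At U ?f" by (rule smooth_fun_const_on[OF U, of _ 1]) simp
  have *: "nabla p v W = nabla p v (\<lambda>q. ?f q *\<^sub>R W q)" if "smooth_vf At U W" for W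
    using nabla_leibniz[OF U that f p] dird_const_on[OF U p, of ?f 1] p by simp
  have "nabla p v Y = nabla p v (\<lambda>q. ?f q *\<^sub>R Y q)" by (rule *[OF Y])
  also have "(\<lambda>q. ?f q *\<^sub>R Y q) = (\<lambda>q. ?f q *\<^sub>R Z q)" using eq by auto
  also have "nabla p v \<dots> = nabla p v Z" by (rule *[OF smooth_vf_cong[OF U Y eq], symmetric])
  finally show ?thesis .
qed

lemma nabla_ext_vf_add:
  assumes "q \<in> cdom (chart_at At p)"
  shows "nabla q v (ext_vf At p (y + z)) = nabla q v (ext_vf At p y) + nabla q v (ext_vf At p z)"
proof -
  have "nabla q v (ext_vf At p (y + z)) = nabla q v (\<lambda>q. ext_vf At p y q + ext_vf At p z q)"
    by (rule nabla_local[OF open_cdom[OF chart_at_in] smooth_ext_vf assms]) (rule ext_vf_add)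
  then show ?thesis
    by (simp add: nabla_add[OF open_cdom[OF chart_at_in] smooth_ext_vf smooth_ext_vf assms])
qed

lemma nabla_ext_vf_scaleR:
  assumes "q \<in> cdom (chart_at At p)"
  shows "nabla q v (ext_vf At p (k *\<^sub>R y)) = k *\<^sub>R nabla q v (ext_vf At p y)"
proof -
  have "nabla q v (ext_vf At p (k *\<^sub>R y)) = nabla q v (\<lambda>q. k *\<^sub>R ext_vf At p y q)"
    by (rule nabla_local[OF open_cdom[OF chart_at_in] smooth_ext_vf assms]) (rule ext_vf_scaleR)
  then show ?thesis
    by (simp add: nabla_scaleR[OF open_cdom[OF chart_at_in] smooth_ext_vf assms])
qed

lemma smooth_nabla_ext_vf:
  "smooth_vf At (cdom (chart_at At p)) (\<lambda>q. nabla q (ext_vf At p y q) (ext_vf At p z))"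
  by (intro smooth_nabla smooth_ext_vf open_cdom chart_at_in)

section \<open>Curvature on coordinate fields and the covariant derivative of a 1-form\<close>

text \<open>The bracket of the extensions is zero at p, and \<open>nabla\<close> along the zero
  vector vanishes by linearity in the direction.\<close>

lemma riem_eq:
  "riem At nabla p x y z =
     nabla p x (\<lambda>q. nabla q (ext_vf At p y q) (ext_vf At p z)) -
     nabla p y (\<lambda>q. nabla q (ext_vf At p x q) (ext_vf At p z))"
  using linear_0[OF linear_nabla[OF open_cdom[OF chart_at_in] smooth_ext_vf mem_chart_at]]
  by (simp add: riem_def curv_op_def lie_bracket_ext_vf)

text \<open>The inner field splits only on the chart domain, so locality of the outer derivative has
  to be used before its additivity or homogeneity.\<close>

lemma linear_nabla_nabla_ext_vf:
  "linear (\<lambda>z. nabla p x (\<lambda>q. nabla q (ext_vf At p y q) (ext_vf At p z)))"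
proof (rule linearI)
  note U = open_cdom[OF chart_at_in]
  fix a b k
  have "nabla p x (\<lambda>q. nabla q (ext_vf At p y q) (ext_vf At p (a + b)))
      = nabla p x (\<lambda>q. nabla q (ext_vf At p y q) (ext_vf At p a) + nabla q (ext_vf At p y q) (ext_vf At p b))"
    by (rule nabla_local[OF U smooth_nabla_ext_vf mem_chart_at]) (rule nabla_ext_vf_add)
  then show "nabla p x (\<lambda>q. nabla q (ext_vf At p y q) (ext_vf At p (a + b)))
      = nabla p x (\<lambda>q. nabla q (ext_vf At p y q) (ext_vf At p a))
      + nabla p x (\<lambda>q. nabla q (ext_vf At p y q) (ext_vf At p b))"
    by (simp add: nabla_add[OF U smooth_nabla_ext_vf smooth_nabla_ext_vf mem_chart_at])
  have "nabla p x (\<lambda>q. nabla q (ext_vf At p y q) (ext_vf At p (k *\<^sub>R a)))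
      = nabla p x (\<lambda>q. k *\<^sub>R nabla q (ext_vf At p y q) (ext_vf At p a))"
    by (rule nabla_local[OF U smooth_nabla_ext_vf mem_chart_at]) (rule nabla_ext_vf_scaleR)
  then show "nabla p x (\<lambda>q. nabla q (ext_vf At p y q) (ext_vf At p (k *\<^sub>R a)))
      = k *\<^sub>R nabla p x (\<lambda>q. nabla q (ext_vf At p y q) (ext_vf At p a))"
    by (simp add: nabla_scaleR[OF U smooth_nabla_ext_vf mem_chart_at])
qed

lemma linear_riem: "linear (riem At nabla p x y)"
  unfolding riem_eq by (intro linear_compose_sub linear_nabla_nabla_ext_vf)

lemma linear_one_form: "one_form At \<pi> \<Longrightarrow> linear (\<pi> p)"
  by (simp add: one_form_def)

lemma smooth_one_form_ext_vf:
  "one_form At \<pi> \<Longrightarrow> smooth_fun At (cdom (chart_at At p)) (\<lambda>q. \<pi> q (ext_vf At p y q))"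
  using smooth_ext_vf open_cdom[OF chart_at_in] unfolding one_form_def by blast

text \<open>Both slots are needed for traces of rank one maps: the first for the Ricci trace, the
  second for 'R4. The first slot is merely a direction of differentiation, but the second is
  extended to a field and enters both terms, so its linearity again needs locality.\<close>

lemma bilinear_nabla_form:
  assumes \<pi>: "one_form At \<pi>"
  shows "bilinear (nabla_form At nabla \<pi> p)"
  unfolding bilinear_def
proof (intro conjI allI)
  note U = open_cdom[OF chart_at_in]
  note lin = linear_one_form[OF \<pi>]
  fix x
  have dird_cong': "dird At (\<lambda>q. \<pi> q (ext_vf At p y q)) p x = dird At h p x"
    if "\<And>q. q \<in> cdom (chart_at At p) \<Longrightarrow> \<pi> q (ext_vf At p y q) = h q" for y h
    using that by (rule dird_cong[OF U smooth_one_form_ext_vf[OF \<pi>] mem_chart_at])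
  show "linear (nabla_form At nabla \<pi> p x)"
  proof (rule linearI)
    fix a b k
    have "dird At (\<lambda>q. \<pi> q (ext_vf At p (a + b) q)) p x
        = dird At (\<lambda>q. \<pi> q (ext_vf At p a q) + \<pi> q (ext_vf At p b q)) p x"
      by (rule dird_cong') (simp add: ext_vf_add linear_add[OF lin])
    then show "nabla_form At nabla \<pi> p x (a + b) = nabla_form At nabla \<pi> p x a + nabla_form At nabla \<pi> p x b"
      by (simp add: nabla_form_def Let_def nabla_ext_vf_add mem_chart_at linear_add[OF lin]
          dird_add[OF smooth_one_form_ext_vf[OF \<pi>] smooth_one_form_ext_vf[OF \<pi>] mem_chart_at])
    have "dird At (\<lambda>q. \<pi> q (ext_vf At p (k *\<^sub>R a) q)) p x = dird At (\<lambda>q. k * \<pi> q (ext_vf At p a q)) p x"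
      by (rule dird_cong') (simp add: ext_vf_scaleR linear_cmul[OF lin])
    then show "nabla_form At nabla \<pi> p x (k *\<^sub>R a) = k *\<^sub>R nabla_form At nabla \<pi> p x a"
      by (simp add: nabla_form_def Let_def nabla_ext_vf_scaleR mem_chart_at linear_cmul[OF lin]
          dird_cmult[OF smooth_one_form_ext_vf[OF \<pi>] mem_chart_at] right_diff_distrib)
  qed
next
  fix y
  show "linear (\<lambda>x. nabla_form At nabla \<pi> p x y)"
    unfolding nabla_form_def Let_def
    by (intro linear_compose_sub linear_dird[OF smooth_one_form_ext_vf[OF \<pi>] mem_chart_at]
        linear_compose[OF linear_nabla[OF open_cdom[OF chart_at_in] smooth_ext_vf mem_chart_at]
          linear_one_form[OF \<pi>], unfolded o_def])
qed

text \<open>Expanding \<open>X (Y (g Z W)) - Y (X (g Z W)) = 0\<close> by metric compatibility.\<close>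

lemma riem_skew:
  assumes g: "riemannian_metric At g" and lc: "levi_civita At g nabla"
  shows "g p (riem At nabla p x y z) w = - g p z (riem At nabla p x y w)"
proof -
  let ?U = "cdom (chart_at At p)"
  let ?E = "ext_vf At p"
  let ?f = "\<lambda>q. g q (?E z q) (?E w q)"
  note U = open_cdom[OF chart_at_in]
  have bil: "bilinear (g q)" for q using g by (simp add: riemannian_metric_def)
  have smooth: "smooth_fun At ?U (\<lambda>q. g q (Y q) (Z q))" if "smooth_vf At ?U Y" "smooth_vf At ?U Z" for Y Z
    using g that U[of p] unfolding riemannian_metric_def by blast
  have compat: "dird At (\<lambda>q. g q (Y q) (Z q)) q v = g q (nabla q v Y) (Z q) + g q (Y q) (nabla q v Z)"
    if "smooth_vf At ?U Y" "smooth_vf At ?U Z" "q \<in> ?U" for Y Z q v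
    using lc that U[of p] unfolding levi_civita_def by blast
  have f: "smooth_fun At ?U ?f" by (intro smooth smooth_ext_vf)
  let ?N = "\<lambda>y z q. nabla q (?E y q) (?E z)"
  have "dird At (\<lambda>q. dird At ?f q (?E y q)) p x
      = g p (nabla p x (?N y z)) w + g p (nabla p y (?E z)) (nabla p x (?E w))
      + (g p (nabla p x (?E z)) (nabla p y (?E w)) + g p z (nabla p x (?N y w)))" for x y
  proof -
    let ?h1 = "\<lambda>q. g q (?N y z q) (?E w q)" and ?h2 = "\<lambda>q. g q (?E z q) (?N y w q)"
    have h: "smooth_fun At ?U ?h1" "smooth_fun At ?U ?h2"
      by (intro smooth smooth_ext_vf smooth_nabla_ext_vf)+
    have eq: "dird At ?f q (?E y q) = ?h1 q + ?h2 q" if "q \<in> ?U" for q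
      by (rule compat[OF smooth_ext_vf smooth_ext_vf that])
    \<comment> \<open>\<open>dird_cong\<close> is read backwards because smoothness is known for
      \<open>?h1\<close> and \<open>?h2\<close>, not in advance for the derivative of
      \<open>?f\<close>.\<close>
    have "dird At (\<lambda>q. dird At ?f q (?E y q)) p x = dird At (\<lambda>q. ?h1 q + ?h2 q) p x"
      by (rule dird_cong[OF U smooth_fun_add[OF U h] mem_chart_at eq[symmetric], symmetric])
    also have "\<dots> = dird At ?h1 p x + dird At ?h2 p x"
      by (rule dird_add[OF h mem_chart_at])
    finally show ?thesis
      by (simp add: compat smooth_ext_vf smooth_nabla_ext_vf mem_chart_at)
  qed
  \<comment> \<open>The mixed products g(\<nabla>Z, \<nabla>W) form a sum symmetric in x and y, so
    they cancel when the two orders are equated.\<close>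
  with dird_ext_vf_commute[OF U f mem_chart_at]
  have "g p (nabla p x (?N y z)) w + g p z (nabla p x (?N y w))
      = g p (nabla p y (?N x z)) w + g p z (nabla p y (?N x w))"
    by (simp add: algebra_simps)
  then show ?thesis
    by (simp add: riem_eq bilinear_lsub[OF bil] bilinear_rsub[OF bil])
qed

end

section \<open>The generator-independent tensor\<close>

text \<open>This also settles independence of the generator, since the right-hand side does not
  contain \<open>\<pi>\<close>.\<close>

lemma H4_eq_weyl_projective:
  fixes At :: "('m::{t2_space, second_countable_topology}, 'n::finite) chart set"
  assumes K: "kaehler_manifold At g A nabla" and \<pi>: "one_form At \<pi>"
  shows "H4 At nabla A \<pi> = weyl_projective At nabla"
proof (intro ext)
  fix p x y z
  have lc: "levi_civita At g nabla" and g: "riemannian_metric At g"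
    and n: "CARD('n) \<ge> 4" and lin: "linear (A p)"
    and square: "A p (A p v) = - v" and herm: "g p (A p v) (A p w) = g p v w" for v w
    using K by (auto simp: kaehler_manifold_def tensor11_def)
  interpret manifold_with_connection At nabla
    using K by unfold_locales (auto simp: kaehler_manifold_def levi_civita_def)
  have bil: "bilinear (g p)" and pos: "\<And>v. v \<noteq> 0 \<Longrightarrow> g p v v > 0"
    using g by (auto simp: riemannian_metric_def)
  have trace_riem: "trace (matrix (riem At nabla p x y)) = 0" for x y
    using bil pos linear_riem
  proof (rule trace_skew)
    show "g p (riem At nabla p x y v) w = - g p v (riem At nabla p x y w)" for v w
      by (rule riem_skew[OF g lc])
  qed
  have "g p (A p v) w = - g p v (A p w)" for v w
    using herm[of v "A p w"] by (simp add: square bilinear_rneg[OF bil])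
  then have trace_A: "trace (matrix (A p)) = 0"
    by (rule trace_skew[OF bil pos lin, rotated])
  define D where "D = D3 At nabla A \<pi> p"
  define R where "R = riem At nabla p"
  have lin\<pi>: "linear (\<pi> p)" by (rule linear_one_form[OF \<pi>])
  have D_left: "linear (\<lambda>x. D x y)" and D_right: "linear (D x)" for x y
  proof -
    have N: "linear (\<lambda>x. nabla_form At nabla \<pi> p x y)" "linear (nabla_form At nabla \<pi> p x)"
      using bilinear_nabla_form[OF \<pi>] by (auto simp: bilinear_def)
    show "linear (\<lambda>x. D x y)"
      using linear_add[OF N(1)] linear_cmul[OF N(1)] linear_add[OF lin\<pi>] linear_cmul[OF lin\<pi>]
      by (intro linearI) (simp_all add: D_def D3_def algebra_simps)
    show "linear (D x)"
      using linear_add[OF N(2)] linear_cmul[OF N(2)] linear_add[OF lin\<pi>] linear_cmul[OF lin\<pi>]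
        linear_add[OF lin] linear_cmul[OF lin]
      by (intro linearI) (simp_all add: D_def D3_def algebra_simps)
  qed
  have R4: "R4 At nabla A \<pi> p x y z = R x y z - D x y *\<^sub>R A p z + D y z *\<^sub>R A p x
      + (\<pi> p z *\<^sub>R \<pi> p y *\<^sub>R x - \<pi> p z *\<^sub>R \<pi> p x *\<^sub>R y)" for x y z
    by (simp add: R4_def R_def D_def scaleR_diff_right)
  \<comment> \<open>The coefficient is written as a product because nested scalar multiples merge
    into that form during simplification.\<close>
  have "linear (\<lambda>z. \<pi> p z * k)" for k
    using linear_add[OF lin\<pi>] linear_cmul[OF lin\<pi>] by (intro linearI) (simp_all add: algebra_simps)
  then have pi_mult: "trace (matrix (\<lambda>z. (\<pi> p z * k) *\<^sub>R w)) = \<pi> p w * k" for k w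
    by (rule trace_matrix_rank_one)
  \<comment> \<open>The quadratic terms contribute \<pi>(X)\<pi>(Y) - \<pi>(Y)\<pi>(X) = 0, so only
    the rank one map sending Z to D(Y,Z)AX survives.\<close>
  have trace_end: "trace_end (R4 At nabla A \<pi>) p x y = D y (A p x)" for x y
    using trace_riem[of x y]
    by (simp add: trace_end_def R4 trace_matrix_add trace_matrix_diff trace_matrix_scaleR trace_A
        trace_matrix_rank_one[OF D_right] pi_mult flip: R_def)
  \<comment> \<open>As maps of X, D(X,Y)AZ has rank one and trace D(AZ,Y), while D(Y,Z)AX is
    trace-free. In the quadratic part the identity map contributes n and the rank one term -1,
    whence the factor n - 1.\<close>
  have ricci: "ricci (R4 At nabla A \<pi>) p y z
      = ricci (riem At nabla) p y z - D (A p z) y + (real CARD('n) - 1) * (\<pi> p y * \<pi> p z)" for y z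
  proof -
    have "trace (matrix (\<lambda>x. \<pi> p z *\<^sub>R \<pi> p x *\<^sub>R y)) = \<pi> p z * \<pi> p y"
      by (simp only: trace_matrix_scaleR trace_matrix_rank_one[OF lin\<pi>])
    moreover have "trace (matrix (\<lambda>x. \<pi> p z *\<^sub>R \<pi> p y *\<^sub>R (x::real^'n))) = \<pi> p z * \<pi> p y * real CARD('n)"
      by (simp only: trace_matrix_scaleR trace_matrix_ident mult.assoc)
    ultimately show ?thesis
      by (simp only: ricci_def R4 trace_matrix_add trace_matrix_diff trace_matrix_scaleR trace_A
          trace_matrix_rank_one[OF D_left]) (simp add: R_def algebra_simps)
  qed
  have D_minus: "D u (- v) = - D u v" for u v
    by (rule linear_neg[OF D_right])
  let ?n = "real CARD('n) - 1"
  have "H4 At nabla A \<pi> p x y z = R x y z + (\<pi> p z *\<^sub>R \<pi> p y *\<^sub>R x - \<pi> p z *\<^sub>R \<pi> p x *\<^sub>R y)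
      - (1 / ?n) *\<^sub>R ((ricci (riem At nabla) p y z + ?n * (\<pi> p y * \<pi> p z)) *\<^sub>R x
        - (ricci (riem At nabla) p x z + ?n * (\<pi> p x * \<pi> p z)) *\<^sub>R y)"
  proof -
    \<comment> \<open>Each Ricci term is paired with its 'R4 term. As 'R4(AY,AZ) = D(AZ,A(AY)) =
      -D(AZ,Y), the D-terms then cancel inside each coefficient.\<close>
    have regroup: "a *\<^sub>R x - b *\<^sub>R y - c *\<^sub>R x + d *\<^sub>R y = (a - c) *\<^sub>R x - (b - d) *\<^sub>R y" for a b c d
      by (simp add: algebra_simps)
    show ?thesis
      unfolding H4_def Let_def regroup by (simp add: R4 ricci trace_end square D_minus)
  qed
  \<comment> \<open>The dimension bound makes \<open>?n\<close> nonzero, so 1/\<open>?n\<close>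
    cancels the factor in front of the quadratic terms, which then match those of R4.\<close>
  also have "\<dots> = R x y z - (1 / ?n) *\<^sub>R (ricci (riem At nabla) p y z *\<^sub>R x - ricci (riem At nabla) p x z *\<^sub>R y)"
    using n by (simp add: scaleR_add_left scaleR_diff_right scaleR_add_right mult.commute)
  also have "\<dots> = weyl_projective At nabla p x y z"
    by (simp add: weyl_projective_def Let_def R_def scaleR_diff_right)
  finally show "H4 At nabla A \<pi> p x y z = weyl_projective At nabla p x y z" .
qed

theorem theorem4p7:
  fixes At :: "('m::{t2_space, second_countable_topology}, 'n::finite) chart set"
    and g :: "'m \<Rightarrow> real ^ 'n \<Rightarrow> real ^ 'n \<Rightarrow> real"
    and A :: "'m \<Rightarrow> real ^ 'n \<Rightarrow> real ^ 'n"
    and nabla nabla1 :: "('m, 'n) conn"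
    and \<pi> :: "'m \<Rightarrow> real ^ 'n \<Rightarrow> real"
  assumes "kaehler_manifold At g A nabla"
    and "one_form At \<pi>"
    and "nabla1 = quarter_symmetric_conn nabla A \<pi>"
  shows "(\<forall>\<pi>'. one_form At \<pi>' \<longrightarrow> H4 At nabla A \<pi> = H4 At nabla A \<pi>') \<and>
    H4 At nabla A \<pi> = weyl_projective At nabla"
  using H4_eq_weyl_projective[OF assms(1)] assms(2) by simp

end
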